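(* Let $a,\lambda,\eta>0$ and $0<\varphi<\frac{1}{\frac1T\|R\|_2^2+\eta\|A\|_2^2}$. Let $x^{*}\in\mathbb{R}^n$ be an optimal solution (global minimizer) of the problem $(FP_{a,\lambda,\eta})$. Then $x^{*}$ is also an optimal solution of the minimization problem $$\min_{x\in\mathbb{R}^n}\Big\{\|x-B_\varphi(x^{*})\|_2^2+\lambda\varphi P_a(x)\Big\}.$$
   Context: Let $T,n$ be positive integers, $r_1,\dots,r_T\in\mathbb{R}^n$ the vectors of asset returns, $R=(r_1,\dots,r_T)^\top\in\mathbb{R}^{T\times n}$, $\mu\in\mathbb{R}^n$ the (given) mean return vector, $\beta\in\mathbb{R}$, $e_m\in\mathbb{R}^m$ the vector of all ones, $A=(\mu,e_n)^\top\in\mathbb{R}^{2\times n}$, $b=(\beta,1)^\top\in\mathbb{R}^2$. For $a>0$ let $\rho_a(t)=\frac{a|t|}{a|t|+1}$ for $t\in\mathbb{R}$ and $P_a(x)=\sum_i\rho_a(x_i)$. For $\lambda,\eta>0$ the problem $(FP_{a,\lambda,\eta})$ is the minimization over $x\in\mathbb{R}^n$ of $$\frac1T\|Rx-\beta e_T\|_2^2+\lambda P_a(x)+\eta\|Ax-b\|_2^2 .$$ For $\varphi>0$ and $z\in\mathbb{R}^n$, $B_\varphi(z)=z+\frac{\varphi}{T}R^\top(\beta e_T-Rz)+\varphi\eta A^\top(b-Az)$. For matrices, $\|\cdot\|_2$ is the spectral norm. *)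

theory Defs
  imports "HOL-Analysis.Analysis"
begin

text \<open>The index type of the sample is \<open>'t\<close> and that of the assets is \<open>'n\<close>, so that
  \<open>T = CARD('t)\<close> and \<open>n = CARD('n)\<close>; both are positive since types are nonempty.\<close>

definition frac_rho :: "real \<Rightarrow> real \<Rightarrow> real"
  where "frac_rho a t = a * \<bar>t\<bar> / (a * \<bar>t\<bar> + 1)"

definition frac_pen :: "real \<Rightarrow> real ^ 'n \<Rightarrow> real"
  where "frac_pen a x = (\<Sum>i\<in>UNIV. frac_rho a (x $ i))"

definition ones :: "real ^ 'm"
  where "ones = (\<chi> i. 1)"

text \<open>The asset returns are the rows of the return matrix.\<close>

definition return_matrix :: "('t::finite \<Rightarrow> real ^ 'n::finite) \<Rightarrow> real ^ 'n ^ 't"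
  where "return_matrix r = (\<chi> t. r t)"

definition constr_matrix :: "real ^ 'n \<Rightarrow> real ^ 'n ^ 2"
  where "constr_matrix \<mu> = vector [\<mu>, ones]"

definition constr_rhs :: "real \<Rightarrow> real ^ 2"
  where "constr_rhs \<beta> = vector [\<beta>, 1]"

text \<open>The norm on \<open>real ^ 'n\<close> is Euclidean, so the operator norm of the induced linear map is
  the spectral norm.\<close>

definition spectral_norm :: "real ^ 'n ^ 'm \<Rightarrow> real"
  where "spectral_norm M = onorm (\<lambda>x. M *v x)"

definition FP_objective ::
    "('t::finite \<Rightarrow> real ^ 'n::finite) \<Rightarrow> real ^ 'n \<Rightarrow> real \<Rightarrow> real \<Rightarrow> real \<Rightarrow> real \<Rightarrow> real ^ 'n \<Rightarrow> real"
  where "FP_objective r \<mu> \<beta> a lam \<eta> x =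
    1 / real CARD('t) * (norm (return_matrix r *v x - \<beta> *\<^sub>R (ones :: real ^ 't)))\<^sup>2
      + lam * frac_pen a x
      + \<eta> * (norm (constr_matrix \<mu> *v x - constr_rhs \<beta>))\<^sup>2"

definition B_op ::
    "('t::finite \<Rightarrow> real ^ 'n::finite) \<Rightarrow> real ^ 'n \<Rightarrow> real \<Rightarrow> real \<Rightarrow> real \<Rightarrow> real ^ 'n \<Rightarrow> real ^ 'n"
  where "B_op r \<mu> \<beta> \<eta> \<phi> z =
    z + (\<phi> / real CARD('t)) *\<^sub>R
          (transpose (return_matrix r) *v (\<beta> *\<^sub>R (ones :: real ^ 't) - return_matrix r *v z))
      + (\<phi> * \<eta>) *\<^sub>R
          (transpose (constr_matrix \<mu>) *v (constr_rhs \<beta> - constr_matrix \<mu> *v z))"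

definition global_minimizer :: "('a \<Rightarrow> real) \<Rightarrow> 'a \<Rightarrow> bool"
  where "global_minimizer f x \<longleftrightarrow> is_arg_min f (\<lambda>_. True) x"

end

theory Submission
  imports Defs
begin

text \<open>The objective of the proximal problem at \<open>x\<close> minus its value at \<open>x\<^sup>*\<close> equals \<open>\<phi>\<close> times the
  corresponding increment of the fractional objective plus
  \<open>\<parallel>d\<parallel>\<^sup>2 - \<phi>/T \<parallel>R d\<parallel>\<^sup>2 - \<phi>\<eta> \<parallel>A d\<parallel>\<^sup>2\<close> with \<open>d = x - x\<^sup>*\<close>, because \<open>B\<^sub>\<phi>(x\<^sup>*) - x\<^sup>*\<close> is \<open>-\<phi>/2\<close> times the
  gradient of the smooth part. The step size bound makes the quadratic remainder nonnegative.\<close>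

lemma norm_matrix_vector_mult_le:
  fixes M :: "real ^ 'n ^ 'm"
  shows "norm (M *v x) \<le> spectral_norm M * norm x"
  unfolding spectral_norm_def by (rule onorm) simp

lemma norm_matrix_vector_mult_sq_le:
  fixes M :: "real ^ 'n ^ 'm"
  shows "(norm (M *v x))\<^sup>2 \<le> (spectral_norm M)\<^sup>2 * (norm x)\<^sup>2"
  using power_mono[OF norm_matrix_vector_mult_le[of M x], of 2] by (simp add: power_mult_distrib)

text \<open>A squared residual is quadratic in \<open>x\<close>, so its second-order Taylor
  expansion at \<open>z\<close> is exact. The linear term is written with \<open>transpose M\<close>
  so that it matches the summands of \<open>B_op\<close>.\<close>

lemma residual_norm_expansion:
  fixes M :: "real ^ 'n ^ 'm"
  shows "(norm (M *v x - c))\<^sup>2 = (norm (M *v z - c))\<^sup>2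
    - 2 * ((x - z) \<bullet> (transpose M *v (c - M *v z))) + (norm (M *v (x - z)))\<^sup>2"
proof -
  \<comment> \<open>With \<open>M\<close> moved across the inner product as an adjoint, what remains
    is the square of \<open>(M *v z - c) + M *v (x - z)\<close>.\<close>
  have "(x - z) \<bullet> (transpose M *v (c - M *v z)) = (M *v (x - z)) \<bullet> (c - M *v z)"
    by (metis dot_lmul_matrix inner_commute transpose_matrix_vector)
  then show ?thesis
    unfolding power2_norm_eq_inner
    by (simp add: matrix_vector_mult_diff_distrib inner_diff_left inner_diff_right inner_commute
        algebra_simps)
qed

text \<open>The penalty increments agree on both sides, and the linear terms agree once both
  residuals are expanded at \<open>z\<close>; only quadratic terms in \<open>x - z\<close> are left
  over.\<close>

lemma proximal_increment:
  fixes r :: "'t::finite \<Rightarrow> real ^ 'n::finite"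
  shows "(norm (x - B_op r \<mu> \<beta> \<eta> \<phi> z))\<^sup>2 + lam * \<phi> * frac_pen a x
      - ((norm (z - B_op r \<mu> \<beta> \<eta> \<phi> z))\<^sup>2 + lam * \<phi> * frac_pen a z)
    = \<phi> * (FP_objective r \<mu> \<beta> a lam \<eta> x - FP_objective r \<mu> \<beta> a lam \<eta> z)
      + ((norm (x - z))\<^sup>2 - \<phi> * (1 / real CARD('t) * (norm (return_matrix r *v (x - z)))\<^sup>2
          + \<eta> * (norm (constr_matrix \<mu> *v (x - z)))\<^sup>2))"
proof -
  let ?R = "return_matrix r" and ?A = "constr_matrix \<mu>"
  let ?u = "transpose ?R *v (\<beta> *\<^sub>R (ones :: real ^ 't) - ?R *v z)"
  let ?v = "transpose ?A *v (constr_rhs \<beta> - ?A *v z)"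
  \<comment> \<open>Measured from \<open>z\<close>, both distances involve the same vector
    \<open>g\<close>, so its squared norm cancels in their difference.\<close>
  define g where "g = B_op r \<mu> \<beta> \<eta> \<phi> z - z"
  have g: "(x - z) \<bullet> g = \<phi> / real CARD('t) * ((x - z) \<bullet> ?u) + \<phi> * \<eta> * ((x - z) \<bullet> ?v)"
    by (simp add: g_def B_op_def inner_add_right)
  have "x - B_op r \<mu> \<beta> \<eta> \<phi> z = (x - z) - g" "z - B_op r \<mu> \<beta> \<eta> \<phi> z = - g"
    by (simp_all add: g_def)
  then have "(norm (x - B_op r \<mu> \<beta> \<eta> \<phi> z))\<^sup>2 - (norm (z - B_op r \<mu> \<beta> \<eta> \<phi> z))\<^sup>2
      = (norm (x - z))\<^sup>2 - 2 * ((x - z) \<bullet> g)"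
    unfolding power2_norm_eq_inner
    by (simp only: inner_diff_left inner_diff_right inner_minus_left inner_minus_right)
      (simp add: inner_commute)
  then show ?thesis
    \<comment> \<open>Fixing \<open>x\<close> and \<open>z\<close> expands only the residuals at
      \<open>x\<close>; those at \<open>z\<close> stay intact and cancel against the objective at
      \<open>z\<close>.\<close>
    unfolding FP_objective_def g
      residual_norm_expansion[of ?R x _ z] residual_norm_expansion[of ?A x _ z]
    by (simp add: algebra_simps)
qed

theorem theorem8:
  fixes r :: "'t::finite \<Rightarrow> real ^ 'n::finite"
    and \<mu> xs :: "real ^ 'n"
    and \<beta> a lam \<eta> \<phi> :: real
  assumes "a > 0" and "lam > 0" and "\<eta> > 0"
    and "0 < \<phi>"
    and "\<phi> < 1 / (1 / real CARD('t) * (spectral_norm (return_matrix r))\<^sup>2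
                  + \<eta> * (spectral_norm (constr_matrix \<mu>))\<^sup>2)"
    and "global_minimizer (FP_objective r \<mu> \<beta> a lam \<eta>) xs"
  shows "global_minimizer
           (\<lambda>x. (norm (x - B_op r \<mu> \<beta> \<eta> \<phi> xs))\<^sup>2 + lam * \<phi> * frac_pen a x) xs"
proof -
  let ?R = "return_matrix r" and ?A = "constr_matrix \<mu>"
  let ?L = "1 / real CARD('t) * (spectral_norm ?R)\<^sup>2 + \<eta> * (spectral_norm ?A)\<^sup>2"
  have "0 < 1 / ?L"
    using assms(4,5) by linarith
  \<comment> \<open>Since \<open>1 / 0 = 0\<close>, a vanishing denominator is excluded here as well.\<close>
  then have "0 < ?L"
    by (simp only: zero_less_divide_1_iff)
  then have step: "\<phi> * ?L \<le> 1"
    using assms(5) by (simp add: less_divide_eq)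
  have remainder: "\<phi> * (1 / real CARD('t) * (norm (?R *v d))\<^sup>2 + \<eta> * (norm (?A *v d))\<^sup>2)
      \<le> (norm d)\<^sup>2" for d
  proof -
    have "1 / real CARD('t) * (norm (?R *v d))\<^sup>2 + \<eta> * (norm (?A *v d))\<^sup>2
        \<le> 1 / real CARD('t) * ((spectral_norm ?R)\<^sup>2 * (norm d)\<^sup>2)
          + \<eta> * ((spectral_norm ?A)\<^sup>2 * (norm d)\<^sup>2)"
      using assms(3) by (intro add_mono mult_left_mono norm_matrix_vector_mult_sq_le) simp_all
    also have "\<dots> = ?L * (norm d)\<^sup>2"
      by (simp add: algebra_simps)
    finally have "\<phi> * (1 / real CARD('t) * (norm (?R *v d))\<^sup>2 + \<eta> * (norm (?A *v d))\<^sup>2)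
        \<le> \<phi> * (?L * (norm d)\<^sup>2)"
      using assms(4) by (intro mult_left_mono) simp_all
    also have "\<dots> = (\<phi> * ?L) * (norm d)\<^sup>2"
      by (rule mult.assoc[symmetric])
    also have "\<dots> \<le> 1 * (norm d)\<^sup>2"
      using step by (intro mult_right_mono) simp_all
    finally show ?thesis
      by simp
  qed
  show ?thesis
    unfolding global_minimizer_def is_arg_min_linorder
  proof (intro conjI allI impI TrueI)
    fix x
    have "FP_objective r \<mu> \<beta> a lam \<eta> xs \<le> FP_objective r \<mu> \<beta> a lam \<eta> x"
      using assms(6) by (simp add: global_minimizer_def is_arg_min_linorder)
    then have "0 \<le> \<phi> * (FP_objective r \<mu> \<beta> a lam \<eta> x - FP_objective r \<mu> \<beta> a lam \<eta> xs)"
      using assms(4) by simp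
    then show "(norm (xs - B_op r \<mu> \<beta> \<eta> \<phi> xs))\<^sup>2 + lam * \<phi> * frac_pen a xs
        \<le> (norm (x - B_op r \<mu> \<beta> \<eta> \<phi> xs))\<^sup>2 + lam * \<phi> * frac_pen a x"
      \<comment> \<open>With base point \<open>xs\<close>, the increment is a sum of two nonnegative
        parts: one by minimality of \<open>xs\<close>, the other by the step size bound.\<close>
      using proximal_increment[of x r \<mu> \<beta> \<eta> \<phi> xs lam a] remainder[of "x - xs"] by linarith
  qed
qed

end
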